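(* As formal power series in $x$ (with integer coefficients), $$\sqrt{\frac{1}{(1-x)(1+3x)}}\equiv \prod_{k=0}^\infty (1-x^{2^k}) \pmod 4 \quad\text{and}\quad \sqrt{\frac{1}{(1-x)(1+3x)}}\equiv \prod_{k=0}^\infty (1-x^{3^k}) \pmod 3.$$
   Context: The square root denotes the formal power series with constant term $1$ whose square is $1/((1-x)(1+3x))$; it has integer coefficients. Congruence of power series modulo $m$ means coefficientwise congruence modulo $m$. *)

theory Defs
  imports
    "HOL-Analysis.Infinite_Products"
    "HOL-Computational_Algebra.Formal_Power_Series"
    "HOL-Number_Theory.Cong"
begin

text \<open>
  The square root is taken over the rationals, where \<open>1 / A\<close> is available as the library's
  division of power series. It is meaningful for series with constant term \<open>1\<close>;
  see \<open>fps_sqrt_ex1\<close>.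
\<close>

definition fps_sqrt :: "rat fps \<Rightarrow> rat fps" where
  "fps_sqrt A = (THE S. fps_nth S 0 = 1 \<and> S ^ 2 = A)"

definition fps_of_int_fps :: "int fps \<Rightarrow> rat fps" where
  "fps_of_int_fps F = Abs_fps (\<lambda>n. of_int (fps_nth F n))"

definition fps_cong :: "int fps \<Rightarrow> int fps \<Rightarrow> int \<Rightarrow> bool" where
  "fps_cong F G m \<longleftrightarrow> (\<forall>n. [fps_nth F n = fps_nth G n] (mod m))"

lemma fps_sqrt_ex1:
  fixes A :: "rat fps"
  assumes "fps_nth A 0 = 1"
  shows "\<exists>!S. fps_nth S 0 = 1 \<and> S ^ 2 = A"
proof (rule ex_ex1I)
  let ?S = "fps_radical (\<lambda>_ _. 1) (Suc (Suc 0)) A"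
  have "?S ^ Suc (Suc 0) = A"
    using assms by (subst power_radical[symmetric]) auto
  then have "fps_nth ?S 0 = 1 \<and> ?S ^ 2 = A"
    by (simp add: numeral_2_eq_2)
  then show "\<exists>S. fps_nth S 0 = 1 \<and> S ^ 2 = A" ..
next
  fix S T :: "rat fps"
  assume S: "fps_nth S 0 = 1 \<and> S ^ 2 = A" and T: "fps_nth T 0 = 1 \<and> T ^ 2 = A"
  then have "S = T \<or> S = - T"
    using power2_eq_iff by metis
  moreover have "S \<noteq> - T"
  proof
    assume "S = - T"
    then have "fps_nth S 0 = - fps_nth T 0" by simp
    with S T show False by simp
  qed
  ultimately show "S = T" by blast
qed

end

theory Submission
  imports Defs "HOL-Computational_Algebra.Formal_Laurent_Series"
begin

text \<open>
  With \<open>y = x / (1 + 3 x)\<close> and \<open>c = y + c\<^sup>2\<close>, an integer power series (the Catalan series in \<open>y\<close>),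
  one has \<open>(1 - 2 c)\<^sup>2 = 1 - 4 y = (1 - x) / (1 + 3 x)\<close>, so the square root is
  \<open>F = (1 - 2 c) / (1 - x)\<close>.

  The products \<open>P\<close> satisfy \<open>P(x) = (1 - x) P(x\<^sup>p)\<close>, and \<open>P(x\<^sup>p) \<equiv> P(x)\<^sup>p\<close> modulo \<open>p\<close>.
  For \<open>p = 3\<close> this gives \<open>(1 - x) P\<^sup>2 \<equiv> 1 \<equiv> (1 - x) F\<^sup>2\<close>, and \<open>F + P\<close> is a unit modulo 3.
  For \<open>p = 2\<close> it gives \<open>(1 - x) P = 1 - 2 d\<close>; since \<open>d(x\<^sup>2) \<equiv> d\<^sup>2\<close> modulo 2, the functional
  equation modulo 4 becomes \<open>(1 + x) (d - d\<^sup>2) \<equiv> x\<close> modulo 2. The series \<open>c\<close> satisfies the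
  same congruence, which has a unique solution without constant term, so \<open>c \<equiv> d\<close> modulo 2.
\<close>

section \<open>Integer power series modulo an integer\<close>

lemma of_int_dvd_fps_iff: "of_int m dvd (f :: int fps) \<longleftrightarrow> (\<forall>n. m dvd fps_nth f n)"
proof
  assume "of_int m dvd f"
  then obtain g where "f = of_int m * g"
    by (rule dvdE)
  then show "\<forall>n. m dvd fps_nth f n"
    by (simp flip: fps_of_int)
next
  assume m: "\<forall>n. m dvd fps_nth f n"
  have "f = of_int m * Abs_fps (\<lambda>n. fps_nth f n div m)"
    by (rule fps_ext) (use m in \<open>simp flip: fps_of_int\<close>)
  then show "of_int m dvd f"
    by (rule dvdI)
qed

text \<open>Turns congruence into divisibility in the ring \<open>int fps\<close>, where polynomial
  identities and cancellation of units apply.\<close>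

lemma fps_cong_iff_dvd: "fps_cong F G m \<longleftrightarrow> of_int m dvd F - G"
  by (simp add: fps_cong_def of_int_dvd_fps_iff cong_iff_dvd_diff)

lemma fps_unit_cancel_left_dvd:
  fixes u f m :: "'a::comm_ring_1 fps"
  assumes u: "fps_nth u 0 = 1" and "m dvd u * f"
  shows "m dvd f"
proof -
  obtain v where v: "u * v = 1"
    using fps_right_inverse[of u 1] u by auto
  have "m dvd v * (u * f)"
    using assms(2) by (rule dvd_mult)
  also have "v * (u * f) = f"
    using v by (metis mult.assoc mult.commute mult_1)
  finally show ?thesis .
qed

text \<open>For 0 < k < p the prime p divides \<open>p choose k\<close>, so only the two end terms
  of the binomial expansion survive.\<close>

lemma prime_dvd_freshmans_dream:
  fixes a b :: "'a::comm_ring_1"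
  assumes p: "prime p"
  shows "of_nat p dvd (a + b) ^ p - (a ^ p + b ^ p)"
proof -
  have "p > 0"
    using p by (rule prime_gt_0_nat)
  have "(a + b) ^ p = (\<Sum>k\<le>p. of_nat (p choose k) * a ^ k * b ^ (p - k))"
    by (rule binomial_ring)
  also have "\<dots> = (\<Sum>k\<in>{0,p}. of_nat (p choose k) * a ^ k * b ^ (p - k))
      + (\<Sum>k\<in>{..p} - {0,p}. of_nat (p choose k) * a ^ k * b ^ (p - k))"
    by (subst add.commute, rule sum.subset_diff) auto
  also have "(\<Sum>k\<in>{0,p}. of_nat (p choose k) * a ^ k * b ^ (p - k)) = a ^ p + b ^ p"
    using \<open>p > 0\<close> by (simp add: add_ac)
  finally have "(a + b) ^ p - (a ^ p + b ^ p)
      = (\<Sum>k\<in>{..p} - {0,p}. of_nat (p choose k) * a ^ k * b ^ (p - k))"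
    by simp
  moreover have "of_nat p dvd (of_nat (p choose k) * a ^ k * b ^ (p - k))"
    if "k \<in> {..p} - {0,p}" for k
  proof -
    have "p dvd p choose k"
      using that p by (intro dvd_choose_prime) auto
    then obtain j where "p choose k = p * j"
      by (rule dvdE)
    then show ?thesis
      by (simp add: mult.assoc)
  qed
  ultimately show ?thesis
    by (metis (no_types, lifting) dvd_sum)
qed

text \<open>Fermat's little theorem: induction over the naturals by the freshman's dream, then
  passage to the residue of \<open>a\<close>, which covers negative integers.\<close>

lemma prime_dvd_power_self_diff:
  fixes a :: int
  assumes p: "prime p"
  shows "int p dvd a ^ p - a"
proof -
  have nonneg: "int p dvd int n ^ p - int n" for n
  proof (induction n)
    case 0
    then show ?case
      using prime_gt_0_nat[OF p] by (simp add: power_0_left)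
  next
    case (Suc n)
    have "int p dvd (int n + 1) ^ p - (int n ^ p + 1 ^ p)"
      using prime_dvd_freshmans_dream[OF p, of "int n" 1] by simp
    from dvd_add[OF this Suc] show ?case
      by (simp add: algebra_simps)
  qed
  have "[a ^ p = (a mod int p) ^ p] (mod int p)"
    by (intro cong_pow) (simp add: cong_def)
  also have "[(a mod int p) ^ p = a mod int p] (mod int p)"
    using nonneg[of "nat (a mod int p)"] prime_gt_0_nat[OF p] by (simp add: cong_iff_dvd_diff)
  also have "[a mod int p = a] (mod int p)"
    by (simp add: cong_def)
  finally show ?thesis
    by (simp add: cong_iff_dvd_diff)
qed

text \<open>Split off the constant term, f = a + x g. The freshman's dream separates the powers,
  Fermat handles a, and the remainder for g carries a factor x^p, so coefficient n reduces to
  coefficient n - p.\<close>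

lemma prime_dvd_fps_power_diff_compose:
  fixes f :: "int fps"
  assumes p: "prime p"
  shows "of_nat p dvd f ^ p - (f oo fps_X ^ p)"
proof -
  have p0: "p > 0"
    using p by (rule prime_gt_0_nat)
  have "int p dvd fps_nth (f ^ p - (f oo fps_X ^ p)) n" for n
  proof (induction n arbitrary: f rule: less_induct)
    case (less n)
    define a where "a = fps_nth f 0"
    define g where "g = fps_shift 1 f"
    have f: "f = fps_const a + fps_X * g"
      unfolding a_def g_def by (rule fps_ext) (auto simp: fps_X_mult_nth)
    define h where "h = f ^ p - ((fps_const a) ^ p + (fps_X * g) ^ p)"
    have h: "int p dvd fps_nth h n"
      using prime_dvd_freshmans_dream[OF p, of "fps_const a" "fps_X * g"]
        of_int_dvd_fps_iff[of "int p" h] unfolding h_def f[symmetric] by simp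
    have "f oo fps_X ^ p = fps_const a + fps_X ^ p * (g oo fps_X ^ p)"
      using p0 by (subst f) (simp add: fps_compose_add_distrib fps_compose_mult_distrib)
    then have eq: "f ^ p - (f oo fps_X ^ p)
        = h + fps_const (a ^ p - a) + fps_X ^ p * (g ^ p - (g oo fps_X ^ p))"
      unfolding h_def
      by (simp add: power_mult_distrib fps_const_power algebra_simps flip: fps_const_sub)
    have "int p dvd fps_nth (fps_const (a ^ p - a)) n"
      using prime_dvd_power_self_diff[OF p, of a] by simp
    moreover have "int p dvd fps_nth (fps_X ^ p * (g ^ p - (g oo fps_X ^ p))) n"
      using less.IH[of "n - p" g] p0 by (simp add: fps_X_power_mult_nth)
    ultimately show ?case
      unfolding eq using h by simp
  qed
  then show ?thesis
    using of_int_dvd_fps_iff[of "int p"] by simp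
qed

section \<open>The infinite products\<close>

lemma fps_mult_one_minus_X_power_nth:
  fixes f :: "'a::comm_ring_1 fps"
  assumes "n < k"
  shows "fps_nth (f * (1 - fps_X ^ k)) n = fps_nth f n"
  using assms by (simp add: right_diff_distrib fps_X_power_mult_right_nth)

lemma prodinf_one_minus_X_power:
  fixes P :: "int fps"
  assumes p: "p > 1" and P: "P = (\<Prod>k. 1 - fps_X ^ (p ^ k))"
  shows "fps_nth P 0 = 1" and "P = (1 - fps_X) * (P oo fps_X ^ p)"
proof -
  define Q :: "nat \<Rightarrow> int fps" where "Q n = (\<Prod>k\<le>n. 1 - fps_X ^ (p ^ k))" for n
  define R where "R = Abs_fps (\<lambda>m. fps_nth (Q m) m)"
  have Q_Suc: "Q (Suc n) = Q n * (1 - fps_X ^ (p ^ Suc n))" for n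
    unfolding Q_def by (simp add: mult.commute)
  have QR: "fps_nth (Q n) m = fps_nth R m" if "m \<le> n" for m n
    using that
  proof (induction rule: dec_induct)
    case base
    then show ?case by (simp add: R_def)
  next
    case (step n)
    \<comment> \<open>The new factor leaves all coefficients up to n + 1 unchanged, so coefficient m
      is stable from \<open>Q m\<close> on.\<close>
    have "Suc n < p ^ Suc n"
      using p by (intro power_gt_expt) simp
    then have "fps_nth (Q (Suc n)) m = fps_nth (Q n) m"
      unfolding Q_Suc using step by (intro fps_mult_one_minus_X_power_nth) simp
    then show ?case
      using step by simp
  qed
  have R0: "fps_nth R 0 = 1"
    by (simp add: R_def Q_def)
  \<comment> \<open>\<open>has_prod\<close> demands a nonzero limit.\<close>
  then have "R \<noteq> 0" by auto
  have "Q \<longlonglongrightarrow> R"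
    by (intro tendsto_fpsI eventually_sequentiallyI) (rule QR)
  with \<open>R \<noteq> 0\<close> have "(\<lambda>k. 1 - fps_X ^ (p ^ k)) has_prod R"
    unfolding has_prod_def raw_has_prod_def by (simp add: Q_def[abs_def])
  then have "P = R"
    unfolding P by (rule has_prod_unique[symmetric])
  with R0 show "fps_nth P 0 = 1" by simp
  \<comment> \<open>Substituting x^p turns each exponent p^k into p^(k+1); only the factor for k = 0
    is then missing.\<close>
  have Q_shift: "Q (Suc n) = (1 - fps_X) * (Q n oo fps_X ^ p)" for n
  proof -
    have "(1 - fps_X ^ (p ^ k) :: int fps) oo fps_X ^ p = 1 - fps_X ^ (p ^ Suc k)" for k
      using p by (simp add: fps_compose_sub_distrib fps_X_power_compose flip: power_mult)
    then have "Q n oo fps_X ^ p = (\<Prod>k\<le>n. 1 - fps_X ^ (p ^ Suc k))"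
      using p unfolding Q_def by (subst fps_compose_prod_distrib) auto
    then show ?thesis
      unfolding Q_def by (subst prod.atMost_Suc_shift) simp
  qed
  have "R = (1 - fps_X) * (R oo fps_X ^ p)"
  proof (rule fps_ext)
    fix m
    have comp: "fps_nth (Q m oo fps_X ^ p) j = fps_nth (R oo fps_X ^ p) j" if "j \<le> m" for j
      using that by (simp add: fps_nth_compose_X_power QR order.trans[OF div_le_dividend])
    have "fps_nth R m = fps_nth (Q (Suc m)) m"
      by (simp add: QR)
    also have "\<dots> = fps_nth ((1 - fps_X) * (R oo fps_X ^ p)) m"
      unfolding Q_shift by (simp add: algebra_simps comp)
    finally show "fps_nth R m = fps_nth ((1 - fps_X) * (R oo fps_X ^ p)) m" .
  qed
  then show "P = (1 - fps_X) * (P oo fps_X ^ p)"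
    using \<open>P = R\<close> by simp
qed

section \<open>The square root\<close>

text \<open>Coefficient recursion of c = y + c^2. The zero constant term removes the ends of the
  convolution, so only earlier coefficients occur. For y = x these are the Catalan numbers, shifted
  by one.\<close>

fun catalan_coeff :: "'a::comm_ring_1 fps \<Rightarrow> nat \<Rightarrow> 'a" where
  "catalan_coeff y n = (if n = 0 then 0
     else fps_nth y n + (\<Sum>i\<in>{1..<n}. catalan_coeff y i * catalan_coeff y (n - i)))"

declare catalan_coeff.simps [simp del]

lemma fps_catalan_equation_ex:
  fixes y :: "'a::comm_ring_1 fps"
  assumes "fps_nth y 0 = 0"
  obtains c where "fps_nth c 0 = 0" and "c = y + c ^ 2"
proof
  define c where "c = Abs_fps (catalan_coeff y)"
  show c0: "fps_nth c 0 = 0"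
    by (simp add: c_def catalan_coeff.simps)
  show "c = y + c ^ 2"
  proof (rule fps_ext)
    fix n
    have "fps_nth (c ^ 2) n = (\<Sum>i\<in>{1..<n}. fps_nth c i * fps_nth c (n - i))"
      unfolding fps_square_nth
      by (rule sum.mono_neutral_right) (use c0 in \<open>auto simp: not_less_eq_eq Suc_le_eq\<close>)
    then show "fps_nth c n = fps_nth (y + c ^ 2) n"
      using assms c0 by (cases "n = 0") (simp_all add: c_def catalan_coeff.simps[of y n])
  qed
qed

text \<open>Reduces the rational square root to a division-free identity over the integers, by the
  uniqueness in \<open>fps_sqrt_ex1\<close>.\<close>

lemma fps_of_int_fps_eq_sqrtI:
  assumes F0: "fps_nth F 0 = 1" and F: "F ^ 2 * G = 1"
  shows "fps_of_int_fps F = fps_sqrt (1 / fps_of_int_fps G)"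
proof -
  have mult: "fps_of_int_fps (A * B) = fps_of_int_fps A * fps_of_int_fps B" for A B
    by (rule fps_ext) (simp add: fps_of_int_fps_def fps_mult_nth)
  have one: "fps_of_int_fps 1 = 1"
    by (rule fps_ext) (simp add: fps_of_int_fps_def)
  have prod: "fps_of_int_fps F ^ 2 * fps_of_int_fps G = 1"
    using arg_cong[OF F, of fps_of_int_fps] by (simp add: mult one power2_eq_square)
  have F0': "fps_nth (fps_of_int_fps F) 0 = 1"
    using F0 by (simp add: fps_of_int_fps_def)
  have G0: "fps_nth (fps_of_int_fps G) 0 = 1"
    using arg_cong[OF prod, of "\<lambda>f. fps_nth f 0"] F0' by (simp add: power2_eq_square)
  then have "1 / fps_of_int_fps G = inverse (fps_of_int_fps G)"
    by (simp add: fps_divide_unit)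
  also have "\<dots> = fps_of_int_fps F ^ 2"
    using prod by (metis fps_inverse_unique mult.commute)
  finally have sq: "fps_of_int_fps F ^ 2 = 1 / fps_of_int_fps G" ..
  have "fps_nth (1 / fps_of_int_fps G) 0 = 1"
    using G0 by simp
  from the1_equality[OF fps_sqrt_ex1[OF this]] F0' sq show ?thesis
    unfolding fps_sqrt_def by simp
qed

theorem theorem1p4:
  shows "\<exists>F :: int fps.
    fps_of_int_fps F = fps_sqrt (1 / ((1 - fps_X) * (1 + 3 * fps_X))) \<and>
    fps_cong F (\<Prod>k. 1 - fps_X ^ (2 ^ k)) 4 \<and>
    fps_cong F (\<Prod>k. 1 - fps_X ^ (3 ^ k)) 3"
proof -
  let ?X = "fps_X :: int fps"
  obtain u where u: "(1 + 3 * ?X) * u = 1"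
    using fps_right_inverse[of "1 + 3 * ?X" 1] by auto
  obtain v where v: "(1 - ?X) * v = 1"
    using fps_right_inverse[of "1 - ?X" 1] by auto
  obtain c where c0: "fps_nth c 0 = 0" and c: "c = ?X * u + c ^ 2"
    using fps_catalan_equation_ex[of "?X * u"] by auto
  have cX: "(1 + 3 * ?X) * (c - c ^ 2) = ?X"
    using u c by algebra
  define F where "F = (1 - 2 * c) * v"
  have FX: "(1 - ?X) * F = 1 - 2 * c"
    unfolding F_def using v by algebra
  have F0: "fps_nth F 0 = 1"
    using arg_cong[OF FX, of "\<lambda>f. fps_nth f 0"] c0 by simp
  have F2: "F ^ 2 * ((1 - ?X) * (1 + 3 * ?X)) = 1"
    unfolding F_def using v cX by algebra

  have "fps_of_int_fps ((1 - ?X) * (1 + 3 * ?X)) = (1 - fps_X) * (1 + 3 * fps_X)"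
    by (rule fps_ext)
      (simp add: fps_of_int_fps_def algebra_simps fps_numeral_fps_const fps_X_nth)
  with fps_of_int_fps_eq_sqrtI[OF F0 F2]
  have sqrt: "fps_of_int_fps F = fps_sqrt (1 / ((1 - fps_X) * (1 + 3 * fps_X)))"
    by simp

  \<comment> \<open>The product over powers of 2, modulo 4\<close>
  define P where "P = (\<Prod>k. 1 - ?X ^ (2 ^ k))"
  have P0: "fps_nth P 0 = 1" and P: "P = (1 - ?X) * (P oo ?X ^ 2)"
    by (rule prodinf_one_minus_X_power[of 2 P]; simp add: P_def)+
  have "4 dvd F - P"
  proof -
    obtain e where e: "P ^ 2 - (P oo ?X ^ 2) = 2 * e"
      using prime_dvd_fps_power_diff_compose[of 2 P] by (auto elim: dvdE)
    \<comment> \<open>Modulo 2 the functional equation reads P = (1 - x) P^2.\<close>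
    have "P * (1 - (1 - ?X) * P) = 2 * (- (1 - ?X) * e)"
      using P e by algebra
    then have "2 dvd P * (1 - (1 - ?X) * P)"
      by (rule dvdI)
    from fps_unit_cancel_left_dvd[OF P0 this]
    obtain d where "1 - (1 - ?X) * P = 2 * d"
      by (rule dvdE)
    then have d: "(1 - ?X) * P = 1 - 2 * d"
      by algebra
    have d0: "fps_nth d 0 = 0"
      using arg_cong[OF d, of "\<lambda>f. fps_nth f 0"] P0 by simp
    have "2 = fps_const (2 :: int)"
      by (rule fps_numeral_fps_const)
    then have "2 oo ?X ^ 2 = 2"
      by simp
    then have dd: "(1 - ?X ^ 2) * (P oo ?X ^ 2) = 1 - 2 * (d oo ?X ^ 2)"
      using arg_cong[OF d, of "\<lambda>f. f oo ?X ^ 2"]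
      by (simp add: fps_compose_sub_distrib fps_compose_mult_distrib)
    obtain e' where e': "d ^ 2 - (d oo ?X ^ 2) = 2 * e'"
      using prime_dvd_fps_power_diff_compose[of 2 d] by (auto elim: dvdE)
    \<comment> \<open>Both sides of \<open>d\<close> times 1 + x, compared with \<open>dd\<close>
      times 1 - x through the functional equation. This is an exact equality, so the factor 2
      cancels.\<close>
    have "2 * ?X = 2 * ((1 + ?X) * d - (1 - ?X) * (d oo ?X ^ 2))"
      using d dd P by algebra
    then have dX: "?X = (1 + ?X) * d - (1 - ?X) * (d oo ?X ^ 2)"
      by (rule mult_left_cancel[THEN iffD1, rotated]) simp
    \<comment> \<open>The left side is (1 + x) ((c - c^2) - (d - d^2)), and both parts contribute x
      modulo 2. The cofactor of c - d has constant term 1.\<close>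
    have "((1 + ?X) * (1 - c - d)) * (c - d)
        = 2 * (?X * d ^ 2 - ?X * (c - c ^ 2) + (1 - ?X) * e')"
      using dX cX e' by algebra
    then have "2 dvd ((1 + ?X) * (1 - c - d)) * (c - d)"
      by (rule dvdI)
    then have "2 dvd c - d"
      by (rule fps_unit_cancel_left_dvd[rotated]) (simp add: c0 d0)
    then obtain k where "c - d = 2 * k"
      by (rule dvdE)
    \<comment> \<open>The left side equals -2 (c - d), which lifts the congruence modulo 2 to one
      modulo 4.\<close>
    then have "(1 - ?X) * (F - P) = 4 * (- k)"
      using FX d by algebra
    then have "4 dvd (1 - ?X) * (F - P)"
      by (rule dvdI)
    then show ?thesis
      by (rule fps_unit_cancel_left_dvd[rotated]) simp
  qed

  \<comment> \<open>The product over powers of 3, modulo 3\<close>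
  moreover define T where "T = (\<Prod>k. 1 - ?X ^ (3 ^ k))"
  have T0: "fps_nth T 0 = 1" and T: "T = (1 - ?X) * (T oo ?X ^ 3)"
    by (rule prodinf_one_minus_X_power[of 3 T]; simp add: T_def)+
  have "3 dvd F - T"
  proof -
    obtain e where e: "T ^ 3 - (T oo ?X ^ 3) = 3 * e"
      using prime_dvd_fps_power_diff_compose[of 3 T] by (auto elim: dvdE)
    \<comment> \<open>Modulo 3 the functional equation reads T = (1 - x) T^3.\<close>
    have "T * (1 - (1 - ?X) * T ^ 2) = 3 * (- (1 - ?X) * e)"
      using T e by algebra
    then have "3 dvd T * (1 - (1 - ?X) * T ^ 2)"
      by (rule dvdI)
    from fps_unit_cancel_left_dvd[OF T0 this]
    obtain d where d: "1 - (1 - ?X) * T ^ 2 = 3 * d"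
      by (rule dvdE)
    \<comment> \<open>\<open>F + T\<close> has constant term 2, so it is replaced by \<open>2 (F + T) - 3\<close> with constant term 1.\<close>
    have "((1 - ?X) * (2 * (F + T) - 3)) * (F - T)
        = 3 * (2 * d - 2 * ?X * F ^ 2 * (1 - ?X) - (1 - ?X) * (F - T))"
      using d F2 by algebra
    then have "3 dvd ((1 - ?X) * (2 * (F + T) - 3)) * (F - T)"
      by (rule dvdI)
    then show ?thesis
      by (rule fps_unit_cancel_left_dvd[rotated]) (simp add: F0 T0)
  qed

  ultimately show ?thesis
    using sqrt by (auto simp: fps_cong_iff_dvd P_def T_def)
qed

end
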